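(* Let $K:\mathbb{N}_0\times\mathbb{N}_0\to\mathbb{C}$ be a positive definite kernel with $K(l,l)=1$ for all $l\in\mathbb{N}_0$, let $\{\gamma_{i,j}\}_{0\le i\le j}$ be the family of parameters associated with $K$, and let $\mathcal{D}^l_m$ and the functions $a_{i,j}$ be as defined in the context. Then, for all $l<m$ in $\mathbb{N}_0$, $$K(l,m)=\sum_{\mathbf{q}\in\mathcal{D}^l_m}\ \prod_{l\le i<j\le m}a_{i,j}(\mathbf{q}).$$
   Context: A kernel $K$ on $\mathbb{N}_0=\{0,1,2,\dots\}$ is positive definite if $\sum_{p,q}K(x_p,x_q)\overline{c_p}c_q\ge 0$ for all finite families $x_p\in\mathbb{N}_0$, $c_p\in\mathbb{C}$. **Parameters.** For a contraction $\gamma\in\mathcal{L}(\mathcal{H}_1,\mathcal{H}_2)$ between Hilbert spaces put $d_\gamma=(I-\gamma^*\gamma)^{1/2}$, let $\mathcal{D}_\gamma\subset\mathcal{H}_1$ be the closure of the range of $d_\gamma$, and let the Julia operator be $$J(\gamma)=\begin{bmatrix}\gamma & d_{\gamma^*}\\ d_\gamma & -\gamma^*\end{bmatrix}:\mathcal{H}_1\oplus\mathcal{D}_{\gamma^*}\to\mathcal{H}_2\oplus\mathcal{D}_\gamma ,$$ which is unitary. Consider families of contractions $\{\gamma_{k,j}\}_{0\le k\le j}$ such that (i) $\gamma_{k,k}=0$ (on $\mathbb{C}$) for all $k$, and (ii) $\gamma_{k,j}\in\mathcal{L}(\mathcal{D}_{\gamma_{k+1,j}},\mathcal{D}_{\gamma^*_{k,j-1}})$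 for $k<j$. Define unitary operators recursively by $U_{k,k}=I_1$ and, for $k<j$, $$U_{k,j}=\big(J(\gamma_{k,k+1})\oplus I_{j-k-1}\big)\big(I_1\oplus J(\gamma_{k,k+2})\oplus I_{j-k-2}\big)\cdots\big(I_{j-k-1}\oplus J(\gamma_{k,j})\big)\big(U_{k+1,j}\oplus I_1\big),$$ where $I_p$ is the identity $p\times p$ block matrix on the appropriate spaces; $U_{k,j}$ is a $(j-k+1)\times(j-k+1)$ block matrix mapping $\mathbb{C}\oplus\mathcal{D}_{\gamma^*_{j-1,j}}\oplus\mathcal{D}_{\gamma^*_{j-2,j}}\oplus\cdots\oplus\mathcal{D}_{\gamma^*_{k,j}}$ onto $\mathbb{C}\oplus\mathcal{D}_{\gamma_{k,k+1}}\oplus\cdots\oplus\mathcal{D}_{\gamma_{k,j}}$. It is known that for every positive definite $K:\mathbb{N}_0\times\mathbb{N}_0\to\mathbb{C}$ with $K(l,l)=1$ for all $l$ there is a unique such family with $K(l,m)=P_{\mathbb{C}}U_{l,m}|_{\mathbb{C}}$ (the upper-left entry of $U_{l,m}$) for all $l\le m$; it is called the family of parameters associated with $K$. Each $\gamma_{i,j}$ acts between subspaces of $\mathbb{C}$ and is identified with a complex number of modulus $\le1$ (the number $0$ when its domain or codomain is $\{0\}$); $\gamma_{i,j}^*$ is its complex conjugate and $d_{i,j}=(1-|\gamma_{i,j}|^2)^{1/2}$. **Dyck paths.** For $l<m$, $\mathcal{D}^l_m$ is the set of lattice paths from $(2l,0)$ to $(2m,0)$ consisting of rise steps $(1,1)$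 and fall steps $(1,-1)$ and never going below height $0$. For $\mathbf{q}\in\mathcal{D}^l_m$ and $l\le i<j\le m$, put $x=(j+i,j-i)$ and $$a_{i,j}(\mathbf{q})=\begin{cases}1 & \text{if } x\notin\mathbf{q};\\ \gamma_{i,j} & \text{if } x\in\mathbf{q}\text{ and at }x\text{ a rise step is followed by a fall step};\\ -\gamma_{i,j}^* & \text{if } x\in\mathbf{q}\text{ and at }x\text{ a fall step is followed by a rise step};\\ d_{i,j} & \text{if } x\in\mathbf{q}\text{ and }\mathbf{q}\text{ has two consecutive rise steps or two consecutive fall steps at }x.\end{cases}$$ *)

theory Defs
  imports "HOL-Analysis.Elementary_Topology" "Jordan_Normal_Form.Matrix"
begin

text \<open>The order on \<^typ>\<open>complex\<close> is the one of \<^theory>\<open>HOL-Library.Complex_Order\<close>, in which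
  \<open>0 \<le> z\<close> says that \<open>z\<close> is real and nonnegative.\<close>

definition pos_def_kernel :: "(nat \<Rightarrow> nat \<Rightarrow> complex) \<Rightarrow> bool" where
  "pos_def_kernel K \<longleftrightarrow>
     (\<forall>(n::nat) (x :: nat \<Rightarrow> nat) (c :: nat \<Rightarrow> complex).
        0 \<le> (\<Sum>p<n. \<Sum>q<n. K (x p) (x q) * cnj (c p) * c q))"

text \<open>A linear operator between subspaces \<open>H1\<close>, \<open>H2\<close> of \<open>\<complex>\<close> is identified with the complex number
  \<open>c\<close> such that it acts as \<open>x \<mapsto> c x\<close>; if \<open>H1 = {0}\<close> or \<open>H2 = {0}\<close> that number is taken to be \<open>0\<close>.
  The adjoint is the conjugate number.\<close>

definition contraction_between :: "complex \<Rightarrow> complex set \<Rightarrow> complex set \<Rightarrow> bool" where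
  "contraction_between c H1 H2 \<longleftrightarrow>
     (\<forall>x\<in>H1. c * x \<in> H2 \<and> cmod (c * x) \<le> cmod x) \<and>
     (H1 = {0} \<or> H2 = {0} \<longrightarrow> c = 0)"

definition defect :: "complex \<Rightarrow> real" where
  "defect c = sqrt (1 - (cmod c)\<^sup>2)"

definition defect_space :: "complex \<Rightarrow> complex set \<Rightarrow> complex set" where
  "defect_space c H1 = closure ((\<lambda>x. complex_of_real (defect c) * x) ` H1)"

definition julia :: "complex \<Rightarrow> complex mat" where
  "julia c = mat_of_rows_list 2
     [[c, complex_of_real (defect (cnj c))],
      [complex_of_real (defect c), - cnj c]]"

text \<open>The domain and codomain of \<open>\<gamma> k j\<close>: both are \<open>\<complex>\<close> for \<open>k = j\<close>, and for \<open>k < j\<close> they are the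
  defect spaces of \<open>\<gamma> (k + 1) j\<close> and of the adjoint of \<open>\<gamma> k (j - 1)\<close>.  The values for \<open>k > j\<close> play no
  role.\<close>

function param_dom :: "(nat \<Rightarrow> nat \<Rightarrow> complex) \<Rightarrow> nat \<Rightarrow> nat \<Rightarrow> complex set" where
  "param_dom \<gamma> k j =
     (if k < j then defect_space (\<gamma> (k + 1) j) (param_dom \<gamma> (k + 1) j) else UNIV)"
  by auto
termination by (relation "Wellfounded.measure (\<lambda>(\<gamma>, k, j). j - k)") auto

function param_cod :: "(nat \<Rightarrow> nat \<Rightarrow> complex) \<Rightarrow> nat \<Rightarrow> nat \<Rightarrow> complex set" where
  "param_cod \<gamma> k j =
     (if k < j then defect_space (cnj (\<gamma> k (j - 1))) (param_cod \<gamma> k (j - 1)) else UNIV)"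
  by auto
termination by (relation "Wellfounded.measure (\<lambda>(\<gamma>, k, j). j - k)") auto

declare param_dom.simps [simp del] param_cod.simps [simp del]

definition parameter_family :: "(nat \<Rightarrow> nat \<Rightarrow> complex) \<Rightarrow> bool" where
  "parameter_family \<gamma> \<longleftrightarrow>
     (\<forall>k. \<gamma> k k = 0) \<and>
     (\<forall>k j. k < j \<longrightarrow> contraction_between (\<gamma> k j) (param_dom \<gamma> k j) (param_cod \<gamma> k j))"

text \<open>The factor \<open>I \<oplus> J(\<gamma> k (k + r)) \<oplus> I\<close> of \<open>U k j\<close>, for \<open>1 \<le> r \<le> j - k\<close>.\<close>

definition julia_factor :: "(nat \<Rightarrow> nat \<Rightarrow> complex) \<Rightarrow> nat \<Rightarrow> nat \<Rightarrow> nat \<Rightarrow> complex mat" where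
  "julia_factor \<gamma> k j r =
     diag_block_mat [1\<^sub>m (r - 1), julia (\<gamma> k (k + r)), 1\<^sub>m (j - k - r)]"

text \<open>The operator \<open>U k j\<close> is the restriction of the following scalar matrix to the direct sum of
  subspaces of \<open>\<complex>\<close> on which it is defined; lemma \<open>param_U_maps\<close> below shows that this
  restriction has the expected domain and codomain.  The \<open>foldr\<close> is the product
  \<open>julia_factor \<gamma> k j 1 * \<dots> * julia_factor \<gamma> k j (j - k) * (U (k + 1) j \<oplus> I)\<close>.\<close>

function param_U :: "(nat \<Rightarrow> nat \<Rightarrow> complex) \<Rightarrow> nat \<Rightarrow> nat \<Rightarrow> complex mat" where
  "param_U \<gamma> k j =
     (if k < j then
        foldr (\<lambda>r A. julia_factor \<gamma> k j r * A) [1..<j - k + 1]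
          (diag_block_mat [param_U \<gamma> (k + 1) j, 1\<^sub>m 1])
      else 1\<^sub>m 1)"
  by auto
termination by (relation "Wellfounded.measure (\<lambda>(\<gamma>, k, j). j - k)") auto

declare param_U.simps [simp del]

definition associated_parameters ::
    "(nat \<Rightarrow> nat \<Rightarrow> complex) \<Rightarrow> (nat \<Rightarrow> nat \<Rightarrow> complex) \<Rightarrow> bool" where
  "associated_parameters K \<gamma> \<longleftrightarrow>
     parameter_family \<gamma> \<and> (\<forall>l m. l \<le> m \<longrightarrow> K l m = param_U \<gamma> l m $$ (0, 0))"

text \<open>Well-definedness of these operators: the scalar matrices map the direct sums of subspaces
  on which the operators are defined into the expected ones.  Note that
  \<open>defect_dom \<gamma> k k = defect_cod \<gamma> k k = \<complex>\<close>, which is the first summand on both sides in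
  \<open>param_U_maps\<close>.\<close>

definition direct_sum_space :: "complex set list \<Rightarrow> complex vec set" where
  "direct_sum_space Hs = {v \<in> carrier_vec (length Hs). \<forall>i<length Hs. v $ i \<in> Hs ! i}"

definition maps_between :: "complex mat \<Rightarrow> complex set list \<Rightarrow> complex set list \<Rightarrow> bool" where
  "maps_between A Hs Ks \<longleftrightarrow>
     A \<in> carrier_mat (length Ks) (length Hs) \<and>
     (\<forall>v\<in>direct_sum_space Hs. A *\<^sub>v v \<in> direct_sum_space Ks)"

definition defect_dom :: "(nat \<Rightarrow> nat \<Rightarrow> complex) \<Rightarrow> nat \<Rightarrow> nat \<Rightarrow> complex set" where
  "defect_dom \<gamma> k j = defect_space (\<gamma> k j) (param_dom \<gamma> k j)"

definition defect_cod :: "(nat \<Rightarrow> nat \<Rightarrow> complex) \<Rightarrow> nat \<Rightarrow> nat \<Rightarrow> complex set" where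
  "defect_cod \<gamma> k j = defect_space (cnj (\<gamma> k j)) (param_cod \<gamma> k j)"

lemma maps_between_mult:
  assumes "maps_between A Hs Ks" "maps_between B Ks Ls"
  shows "maps_between (B * A) Hs Ls"
  using assms unfolding maps_between_def
  by (auto simp: direct_sum_space_def assoc_mult_mat_vec[where ?n\<^sub>2.0 = "length Ks"])

lemma maps_between_one: "n = length Hs \<Longrightarrow> maps_between (1\<^sub>m n) Hs Hs"
  unfolding maps_between_def direct_sum_space_def by auto

lemma direct_sum_space_append:
  assumes "v \<in> carrier_vec (length Hs)" "w \<in> carrier_vec (length Ks)"
  shows "v @\<^sub>v w \<in> direct_sum_space (Hs @ Ks) \<longleftrightarrow>
    v \<in> direct_sum_space Hs \<and> w \<in> direct_sum_space Ks" (is "?l \<longleftrightarrow> ?r")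
proof
  assume ?l
  then have *: "\<And>i. i < length Hs + length Ks \<Longrightarrow> (v @\<^sub>v w) $ i \<in> (Hs @ Ks) ! i"
    by (auto simp: direct_sum_space_def)
  have "v $ i \<in> Hs ! i" if "i < length Hs" for i
    using *[of i] that assms by (auto simp: nth_append)
  moreover have "w $ i \<in> Ks ! i" if "i < length Ks" for i
    using *[of "length Hs + i"] that assms by (auto simp: nth_append)
  ultimately show ?r
    using assms by (auto simp: direct_sum_space_def)
next
  assume ?r
  then show ?l
    using assms by (auto simp: direct_sum_space_def nth_append)
qed

lemma maps_between_four_block:
  assumes A: "maps_between A Hs Ks" and B: "maps_between B Hs' Ks'"
  shows "maps_between (four_block_mat A (0\<^sub>m (dim_row A) (dim_col B)) (0\<^sub>m (dim_row B) (dim_col A)) B)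
    (Hs @ Hs') (Ks @ Ks')" (is "maps_between ?M _ _")
  unfolding maps_between_def
proof (intro conjI ballI)
  have cA: "A \<in> carrier_mat (length Ks) (length Hs)" and cB: "B \<in> carrier_mat (length Ks') (length Hs')"
    using A B by (auto simp: maps_between_def)
  then show "?M \<in> carrier_mat (length (Ks @ Ks')) (length (Hs @ Hs'))"
    by auto
  fix v assume v: "v \<in> direct_sum_space (Hs @ Hs')"
  then have cv: "v \<in> carrier_vec (length Hs + length Hs')"
    by (auto simp: direct_sum_space_def)
  define a where "a = vec_first v (length Hs)"
  define b where "b = vec_last v (length Hs')"
  have ca: "a \<in> carrier_vec (length Hs)" "b \<in> carrier_vec (length Hs')"
    by (auto simp: a_def b_def)
  have vab: "v = a @\<^sub>v b"
    using cv by (simp add: a_def b_def)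
  have ab: "a \<in> direct_sum_space Hs" "b \<in> direct_sum_space Hs'"
    using v direct_sum_space_append[OF ca] unfolding vab by auto
  have dims: "dim_row A = length Ks" "dim_col A = length Hs" "dim_row B = length Ks'" "dim_col B = length Hs'"
    using cA cB by auto
  have "?M *\<^sub>v v = (A *\<^sub>v a + 0\<^sub>m (length Ks) (length Hs') *\<^sub>v b) @\<^sub>v
      (0\<^sub>m (length Ks') (length Hs) *\<^sub>v a + B *\<^sub>v b)"
    unfolding vab dims
    by (rule four_block_mat_mult_vec[OF cA _ _ cB ca]) auto
  also have "\<dots> = (A *\<^sub>v a) @\<^sub>v (B *\<^sub>v b)"
    using ca cA cB by auto
  also have "\<dots> \<in> direct_sum_space (Ks @ Ks')"
    using direct_sum_space_append[of "A *\<^sub>v a" Ks "B *\<^sub>v b" Ks'] A B ab cA cB ca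
    by (auto simp: maps_between_def)
  finally show "?M *\<^sub>v v \<in> direct_sum_space (Ks @ Ks')" .
qed

lemma defect_cnj: "defect (cnj c) = defect c"
  by (simp add: defect_def)

lemma defect_space_trivial:
  assumes "H = {0} \<or> H = UNIV"
  shows "defect_space c H = (if defect c = 0 then {0} else H)"
proof (cases "defect c = 0 \<or> H = {0}")
  case True
  then show ?thesis using assms by (auto simp: defect_space_def image_constant_conv)
next
  case False
  then have H: "H = UNIV" and d: "defect c \<noteq> 0" using assms by auto
  have "y \<in> (\<lambda>x. complex_of_real (defect c) * x) ` UNIV" for y
    using d by (intro image_eqI[where x = "y / complex_of_real (defect c)"]) auto
  then have "(\<lambda>x. complex_of_real (defect c) * x) ` UNIV = UNIV" by blast
  then show ?thesis using d by (simp add: defect_space_def H)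
qed

lemma direct_sum_space_pair:
  "v \<in> direct_sum_space [H, H'] \<longleftrightarrow> dim_vec v = 2 \<and> v $ 0 \<in> H \<and> v $ 1 \<in> H'"
proof -
  have "(\<forall>i<Suc (Suc 0). P i) \<longleftrightarrow> P 0 \<and> P (Suc 0)" for P
    by (auto simp: less_Suc_eq_0_disj)
  note this[of "\<lambda>i. v $ i \<in> [H, H'] ! i"]
  moreover have "length [H, H'] = Suc (Suc 0)" "[H, H'] ! 0 = H" "[H, H'] ! Suc 0 = H'"
    by simp_all
  ultimately show ?thesis
    unfolding direct_sum_space_def mem_Collect_eq carrier_dim_vec by (simp only: numeral_2_eq_2 One_nat_def)
qed

lemma maps_between_julia:
  assumes H: "H1 = {0} \<or> H1 = UNIV" "H2 = {0} \<or> H2 = UNIV" and c: "contraction_between c H1 H2"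
  shows "maps_between (julia c) [H1, defect_space (cnj c) H2] [H2, defect_space c H1]"
proof -
  have 1: "H1 = {0} \<or> H2 = {0} \<Longrightarrow> c = 0"
    using c unfolding contraction_between_def by blast
  have D: "defect_space (cnj c) H2 = (if defect c = 0 then {0} else H2)"
    "defect_space c H1 = (if defect c = 0 then {0} else H1)"
    using defect_space_trivial[OF H(2), of "cnj c"] defect_space_trivial[OF H(1), of c]
    unfolding defect_cnj by blast+
  have "julia c *\<^sub>v v \<in> direct_sum_space [H2, defect_space c H1]"
    if v: "v \<in> direct_sum_space [H1, defect_space (cnj c) H2]" for v
  proof -
    have v2: "dim_vec v = 2" "v $ 0 \<in> H1" "v $ 1 \<in> defect_space (cnj c) H2"
      using v by (simp_all add: direct_sum_space_pair)
    have i: "(julia c *\<^sub>v v) $ 0 = c * v $ 0 + defect c * v $ 1"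
      "(julia c *\<^sub>v v) $ 1 = defect c * v $ 0 - cnj c * v $ 1"
      using v2(1) by (simp_all add: julia_def mat_of_rows_list_def scalar_prod_def
          numeral_2_eq_2 defect_cnj)
    have "(julia c *\<^sub>v v) $ 0 \<in> H2"
    proof (cases "H2 = {0}")
      case True
      then have "c = 0" "v $ 1 = 0" using 1 v2(3) unfolding D by (simp_all split: if_splits)
      then show ?thesis unfolding i True by simp
    next
      case False
      then have "H2 = UNIV" using H(2) by blast
      then show ?thesis by simp
    qed
    moreover have "(julia c *\<^sub>v v) $ 1 \<in> defect_space c H1"
    proof (cases "defect c = 0 \<or> H1 = {0}")
      case True
      have "defect c * v $ 0 = 0" using True v2(2) by auto
      moreover have "cnj c * v $ 1 = 0"
      proof (cases "defect c = 0")
        case True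
        then have "v $ 1 = 0" using v2(3) unfolding D by simp
        then show ?thesis by simp
      next
        case False
        then have "c = 0" using True 1 by blast
        then show ?thesis by simp
      qed
      ultimately have "(julia c *\<^sub>v v) $ 1 = 0" unfolding i by (simp only: diff_self)
      then show ?thesis using True unfolding D by auto
    next
      case False
      then have "defect_space c H1 = UNIV" using H(1) unfolding D by simp
      then show ?thesis by simp
    qed
    moreover have "dim_vec (julia c *\<^sub>v v) = 2"
      by (simp add: julia_def mat_of_rows_list_def)
    ultimately show ?thesis
      by (simp only: direct_sum_space_pair)
  qed
  moreover have "julia c \<in> carrier_mat 2 2"
    by (intro carrier_matI) (simp_all add: julia_def mat_of_rows_list_def)
  moreover have "length [H, H'] = 2" for H H' :: "complex set"
    by simp
  ultimately show ?thesis
    unfolding maps_between_def by (metis (no_types))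
qed

lemma param_dom_trivial: "param_dom \<gamma> k j = {0} \<or> param_dom \<gamma> k j = UNIV"
proof (induction \<gamma> k j rule: param_dom.induct)
  case (1 \<gamma> k j)
  show ?case
  proof (cases "k < j")
    case True
    then show ?thesis
      using defect_space_trivial[OF 1[OF True]] 1[OF True] param_dom.simps[of \<gamma> k j] by metis
  qed (simp add: param_dom.simps[of \<gamma> k j])
qed

lemma param_cod_trivial: "param_cod \<gamma> k j = {0} \<or> param_cod \<gamma> k j = UNIV"
proof (induction \<gamma> k j rule: param_cod.induct)
  case (1 \<gamma> k j)
  show ?case
  proof (cases "k < j")
    case True
    then show ?thesis
      using defect_space_trivial[OF 1[OF True]] 1[OF True] param_cod.simps[of \<gamma> k j] by metis
  qed (simp add: param_cod.simps[of \<gamma> k j])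
qed

lemma defect_diag:
  assumes "parameter_family \<gamma>"
  shows "defect_dom \<gamma> k k = UNIV" "defect_cod \<gamma> k k = UNIV"
proof -
  have "\<gamma> k k = 0" using assms by (simp add: parameter_family_def)
  moreover have "defect 0 = 1" by (simp add: defect_def)
  ultimately show "defect_dom \<gamma> k k = UNIV" "defect_cod \<gamma> k k = UNIV"
    by (simp_all add: defect_dom_def defect_cod_def param_dom.simps[of \<gamma> k k]
        param_cod.simps[of \<gamma> k k] defect_space_trivial)
qed

lemma julia_factor_maps:
  assumes "parameter_family \<gamma>" "1 \<le> r" "k + r \<le> j"
  shows "maps_between (julia_factor \<gamma> k j r)
    (map (defect_dom \<gamma> (k + 1)) [k + 1..<k + r + 1] @ [defect_cod \<gamma> k (k + r)] @
       map (defect_dom \<gamma> k) [k + r + 1..<j + 1])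
    (map (defect_dom \<gamma> (k + 1)) [k + 1..<k + r] @ [defect_cod \<gamma> k (k + r - 1)] @
       map (defect_dom \<gamma> k) [k + r..<j + 1])"
proof -
  let ?X = "map (defect_dom \<gamma> (k + 1)) [k + 1..<k + r]"
  let ?Y = "map (defect_dom \<gamma> k) [k + r + 1..<j + 1]"
  have d: "param_dom \<gamma> k (k + r) = defect_dom \<gamma> (k + 1) (k + r)"
    "param_cod \<gamma> k (k + r) = defect_cod \<gamma> k (k + r - 1)"
    using assms by (subst param_dom.simps param_cod.simps; simp add: defect_dom_def defect_cod_def)+
  have "maps_between (julia (\<gamma> k (k + r)))
      [defect_dom \<gamma> (k + 1) (k + r), defect_cod \<gamma> k (k + r)]
      [defect_cod \<gamma> k (k + r - 1), defect_dom \<gamma> k (k + r)]"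
  proof -
    have "contraction_between (\<gamma> k (k + r)) (param_dom \<gamma> k (k + r)) (param_cod \<gamma> k (k + r))"
      using assms by (simp add: parameter_family_def)
    from maps_between_julia[OF param_dom_trivial param_cod_trivial this] show ?thesis
      by (simp only: d defect_dom_def[of \<gamma> k "k + r"] defect_cod_def[of \<gamma> k "k + r"])
  qed
  then have "maps_between (julia_factor \<gamma> k j r)
      (?X @ [defect_dom \<gamma> (k + 1) (k + r), defect_cod \<gamma> k (k + r)] @ ?Y)
      (?X @ [defect_cod \<gamma> k (k + r - 1), defect_dom \<gamma> k (k + r)] @ ?Y)"
    unfolding julia_factor_def
      diag_block_mat.simps(2)[of "1\<^sub>m (r - 1)"] diag_block_mat.simps(2)[of "julia (\<gamma> k (k + r))"]
      diag_block_mat_singleton Let_def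
    by (intro maps_between_four_block maps_between_one) (use assms in auto)
  moreover have "[k + 1..<k + r + 1] = [k + 1..<k + r] @ [k + r]"
    using assms by simp
  moreover have "[k + r..<j + 1] = (k + r) # [k + r + 1..<j + 1]"
    using assms upt_conv_Cons[of "k + r" "j + 1"] by (simp_all del: upt_Suc)
  ultimately show ?thesis by (simp del: upt_Suc)
qed

lemma param_U_maps:
  assumes "parameter_family \<gamma>" "k \<le> j"
  shows "maps_between (param_U \<gamma> k j)
    (map (\<lambda>i. defect_cod \<gamma> i j) (rev [k..<j + 1])) (map (defect_dom \<gamma> k) [k..<j + 1])"
  using assms
proof (induction \<gamma> k j rule: param_U.induct)
  case (1 \<gamma> k j)
  show ?case
  proof (cases "k < j")
    case False
    then show ?thesis
      using 1 by (subst param_U.simps) (auto simp: defect_diag intro!: maps_between_one)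
  next
    case True
    let ?D = "map (\<lambda>i. defect_cod \<gamma> i j) (rev [k..<j + 1])"
    let ?L = "\<lambda>r. map (defect_dom \<gamma> (k + 1)) [k + 1..<k + r] @ [defect_cod \<gamma> k (k + r - 1)] @
       map (defect_dom \<gamma> k) [k + r..<j + 1]"
    let ?A = "diag_block_mat [param_U \<gamma> (k + 1) j, 1\<^sub>m 1]"
    have "rev [k..<j + 1] = rev [k + 1..<j + 1] @ [k]"
      using True by (simp add: upt_conv_Cons del: upt_Suc)
    then have D: "?D = map (\<lambda>i. defect_cod \<gamma> i j) (rev [k + 1..<j + 1]) @ [defect_cod \<gamma> k j]"
      by simp
    have L: "?L (j - k + 1) = map (defect_dom \<gamma> (k + 1)) [k + 1..<j + 1] @ [defect_cod \<gamma> k j]"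
      using True by simp
    have base: "maps_between ?A ?D (?L (j - k + 1))"
      unfolding D L diag_block_mat.simps(2)[of "param_U \<gamma> (k + 1) j"] diag_block_mat_singleton Let_def
      by (intro maps_between_four_block maps_between_one) (use 1 True in auto)
    have "maps_between (foldr (\<lambda>r A. julia_factor \<gamma> k j r * A) [s..<j - k + 1] ?A) ?D (?L s)"
      if "s \<le> j - k + 1" "1 \<le> s" for s
      using that
    proof (induction s rule: inc_induct)
      case base
      then show ?case using \<open>maps_between ?A ?D (?L (j - k + 1))\<close> by simp
    next
      case (step s)
      have "maps_between (julia_factor \<gamma> k j s) (?L (Suc s)) (?L s)"
      proof -
        have "k + s \<le> j" using step.hyps True by linarith
        from julia_factor_maps[OF \<open>parameter_family \<gamma>\<close> step.prems this] show ?thesis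
          by (simp del: upt_Suc)
      qed
      moreover have "[s..<j - k + 1] = s # [Suc s..<j - k + 1]"
        using step.hyps by (intro upt_conv_Cons) simp
      ultimately show ?case
        using maps_between_mult[OF step.IH] step.prems by (simp del: upt_Suc)
    qed
    from this[of 1] have "maps_between (param_U \<gamma> k j) ?D (?L 1)"
      using True unfolding param_U.simps[of \<gamma> k j] by (simp del: upt_Suc)
    moreover have "?L 1 = map (defect_dom \<gamma> k) [k..<j + 1]"
      using upt_conv_Cons[of k "j + 1"] True
      by (simp add: defect_diag[OF \<open>parameter_family \<gamma>\<close>] del: upt_Suc)
    ultimately show ?thesis by (simp only:)
  qed
qed

datatype step = Rise | Fall

fun step_height :: "step \<Rightarrow> int" where
  "step_height Rise = 1"
| "step_height Fall = -1"

text \<open>A path from \<open>(2l, 0)\<close> is given by its list of steps \<open>q\<close>; after \<open>t\<close> steps it is at the point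
  \<open>(2l + t, path_height q t)\<close>.\<close>

definition path_height :: "step list \<Rightarrow> nat \<Rightarrow> int" where
  "path_height q t = sum_list (map step_height (take t q))"

definition dyck_paths :: "nat \<Rightarrow> nat \<Rightarrow> step list set" where
  "dyck_paths l m =
     {q. length q = 2 * (m - l) \<and> (\<forall>t\<le>length q. 0 \<le> path_height q t) \<and>
         path_height q (length q) = 0}"

text \<open>The path \<open>q\<close> (starting at \<open>(2l, 0)\<close>) has abscissa \<open>j + i\<close> after \<open>t = j + i - 2l\<close> steps;
  for \<open>l \<le> i < j \<le> m\<close> one has \<open>0 < t < length q\<close>, so that the steps \<open>q ! (t - 1)\<close> and \<open>q ! t\<close> before
  and after that point exist.\<close>

definition dyck_weight ::
    "(nat \<Rightarrow> nat \<Rightarrow> complex) \<Rightarrow> nat \<Rightarrow> step list \<Rightarrow> nat \<Rightarrow> nat \<Rightarrow> complex" where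
  "dyck_weight \<gamma> l q i j =
     (let t = j + i - 2 * l in
      if path_height q t \<noteq> int j - int i then 1
      else if q ! (t - 1) = Rise \<and> q ! t = Fall then \<gamma> i j
      else if q ! (t - 1) = Fall \<and> q ! t = Rise then - cnj (\<gamma> i j)
      else complex_of_real (defect (\<gamma> i j)))"

lemma finite_dyck_paths: "finite (dyck_paths l m)"
proof (rule finite_subset)
  have "(UNIV :: step set) = {Rise, Fall}"
    using step.exhaust by auto
  then have "finite (UNIV :: step set)"
    by (metis finite.simps)
  then show "finite {q :: step list. set q \<subseteq> UNIV \<and> length q = 2 * (m - l)}"
    by (rule finite_lists_length_eq)
qed (auto simp: dyck_paths_def)

end

theory Submission
  imports Defs
begin

text \<open>In the product defining \<open>U l m\<close>, the factor \<open>J(\<gamma> i j)\<close> sits at the lattice point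
  \<open>(j + i, j - i)\<close>: its upper row and column belong to a path that enters by a rise, respectively
  leaves by a fall, and its lower row and column to one that enters by a fall, respectively leaves
  by a rise.  Expanding the matrix product along a column therefore enumerates lattice paths, and
  the entry \<open>(p, 0)\<close> of \<open>U i m\<close> is the sum of the weights of all nonnegative paths from
  \<open>(2i + p, p)\<close> to \<open>(2m, 0)\<close> whose preceding step was a fall.\<close>

section \<open>Sums over lattice paths\<close>

text \<open>The value 1 for \<open>i = j\<close> keeps axis points out of the weight: the product in
  the theorem runs over \<open>i < j\<close> only.\<close>

definition node_weight ::
    "(nat \<Rightarrow> nat \<Rightarrow> complex) \<Rightarrow> nat \<Rightarrow> nat \<Rightarrow> step \<Rightarrow> step \<Rightarrow> complex" where
  "node_weight \<gamma> i j s t =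
     (if i = j then 1
      else if s = Rise \<and> t = Fall then \<gamma> i j
      else if s = Fall \<and> t = Rise then - cnj (\<gamma> i j)
      else complex_of_real (defect (\<gamma> i j)))"

text \<open>The argument \<open>s\<close> is the step by which the point \<open>(j + i, j - i)\<close> was reached.\<close>

fun path_weight ::
    "(nat \<Rightarrow> nat \<Rightarrow> complex) \<Rightarrow> nat \<Rightarrow> nat \<Rightarrow> step \<Rightarrow> step list \<Rightarrow> complex" where
  "path_weight \<gamma> i j s [] = 1"
| "path_weight \<gamma> i j s (Rise # q) = node_weight \<gamma> i j s Rise * path_weight \<gamma> i (Suc j) Rise q"
| "path_weight \<gamma> i j s (Fall # q) = node_weight \<gamma> i j s Fall * path_weight \<gamma> (Suc i) j Fall q"

text \<open>Heights are integers, so that a fall from the axis leads to height -1 and to an empty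
  set; the split by first step then has no boundary case.\<close>

definition paths_from :: "int \<Rightarrow> nat \<Rightarrow> step list set" where
  "paths_from h n =
     {q. length q = n \<and> (\<forall>t\<le>n. 0 \<le> h + path_height q t) \<and> h + path_height q n = 0}"

lemma dyck_paths_eq_paths_from: "dyck_paths l m = paths_from 0 (2 * (m - l))"
  by (auto simp: dyck_paths_def paths_from_def)

lemma path_height_0 [simp]: "path_height q 0 = 0"
  by (simp add: path_height_def)

lemma path_height_Cons [simp]: "path_height (s # q) (Suc t) = step_height s + path_height q t"
  by (simp add: path_height_def)

lemma path_height_ge: "- int t \<le> path_height q t"
proof (induction t arbitrary: q)
  case (Suc t)
  show ?case
  proof (cases q)
    case Nil
    then show ?thesis by (simp add: path_height_def)
  next
    case (Cons s q')
    then show ?thesis using Suc.IH[of q'] by (cases s) auto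
  qed
qed simp

lemma paths_from_neg: "h < 0 \<Longrightarrow> paths_from h n = {}"
  by (force simp: paths_from_def)

lemma paths_from_high: "int n < h \<Longrightarrow> paths_from h n = {}"
  using path_height_ge[of n]
  by (smt (verit) Collect_empty_eq paths_from_def)

lemma paths_from_0: "paths_from 0 0 = {[]}"
  by (auto simp: paths_from_def)

lemma Cons_mem_paths_from:
  assumes "0 \<le> h"
  shows "s # q \<in> paths_from h (Suc n) \<longleftrightarrow> q \<in> paths_from (h + step_height s) n"
proof -
  have "(\<forall>t\<le>Suc n. 0 \<le> h + path_height (s # q) t) \<longleftrightarrow>
      (\<forall>t\<le>n. 0 \<le> h + step_height s + path_height q t)"
    using assms by (auto simp: All_less_Suc2 simp flip: less_Suc_eq_le)
  then show ?thesis
    by (auto simp: paths_from_def)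
qed

lemma paths_from_Suc:
  assumes "0 \<le> h"
  shows "paths_from h (Suc n) = (#) Rise ` paths_from (h + 1) n \<union> (#) Fall ` paths_from (h - 1) n"
proof (rule Set.set_eqI)
  fix q
  show "q \<in> paths_from h (Suc n) \<longleftrightarrow>
    q \<in> (#) Rise ` paths_from (h + 1) n \<union> (#) Fall ` paths_from (h - 1) n"
  proof (cases q)
    case Nil
    then show ?thesis by (auto simp: paths_from_def)
  next
    case (Cons s q')
    then show ?thesis using Cons_mem_paths_from[OF assms, of s q' n] by (cases s) auto
  qed
qed

lemma finite_paths_from: "finite (paths_from h n)"
proof (induction n arbitrary: h)
  case 0
  show ?case by (rule finite_subset[of _ "{[]}"]) (auto simp: paths_from_def)
next
  case (Suc n)
  then show ?case
    by (cases "0 \<le> h") (auto simp: paths_from_Suc paths_from_neg)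
qed

definition path_sum ::
    "(nat \<Rightarrow> nat \<Rightarrow> complex) \<Rightarrow> nat \<Rightarrow> nat \<Rightarrow> nat \<Rightarrow> step \<Rightarrow> complex" where
  "path_sum \<gamma> m i j s =
     (\<Sum>q\<in>paths_from (int j - int i) (2 * m - i - j). path_weight \<gamma> i j s q)"

lemma path_sum_end: "path_sum \<gamma> m m m s = 1"
  by (simp add: path_sum_def paths_from_0)

lemma path_sum_neg: "j < i \<Longrightarrow> path_sum \<gamma> m i j s = 0"
  by (simp add: path_sum_def paths_from_neg)

lemma path_sum_high: "i \<le> m \<Longrightarrow> m < j \<Longrightarrow> path_sum \<gamma> m i j s = 0"
  by (subst path_sum_def, subst paths_from_high) auto

text \<open>Split by the first step. For \<open>i < j\<close> the coefficients for
  \<open>s = Rise\<close> and \<open>s = Fall\<close> are the upper and the lower row of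
  \<open>julia (\<gamma> i j)\<close>, whose first column belongs to the fall.\<close>

lemma path_sum_rec:
  assumes "i \<le> j" "i + j < 2 * m"
  shows "path_sum \<gamma> m i j s = node_weight \<gamma> i j s Rise * path_sum \<gamma> m i (Suc j) Rise
     + node_weight \<gamma> i j s Fall * path_sum \<gamma> m (Suc i) j Fall"
proof -
  define n where "n = 2 * m - i - Suc j"
  have n: "2 * m - i - j = Suc n" "2 * m - i - Suc j = n" "2 * m - Suc i - j = n"
    using assms by (auto simp: n_def)
  have h: "int (Suc j) - int i = int j - int i + 1" "int j - int (Suc i) = int j - int i - 1"
    by auto
  have "path_sum \<gamma> m i j s =
      (\<Sum>q\<in>(#) Rise ` paths_from (int j - int i + 1) n. path_weight \<gamma> i j s q)
      + (\<Sum>q\<in>(#) Fall ` paths_from (int j - int i - 1) n. path_weight \<gamma> i j s q)"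
    unfolding path_sum_def n using assms
    by (subst paths_from_Suc) (auto intro!: sum.union_disjoint finite_paths_from)
  then show ?thesis
    unfolding path_sum_def n h by (simp add: sum.reindex sum_distrib_left)
qed

section \<open>The column recursion for \<open>U k j\<close>\<close>

lemma julia_carrier [simp]: "julia c \<in> carrier_mat 2 2" "dim_row (julia c) = 2" "dim_col (julia c) = 2"
  by (auto simp: julia_def mat_of_rows_list_def)

lemma julia_index:
  "julia c $$ (0, 0) = c" "julia c $$ (0, Suc 0) = complex_of_real (defect c)"
  "julia c $$ (Suc 0, 0) = complex_of_real (defect c)" "julia c $$ (Suc 0, Suc 0) = - cnj c"
  by (simp_all add: julia_def mat_of_rows_list_def defect_cnj)

text \<open>Writing \<open>j\<close> as \<open>k + (Suc r + a)\<close> removes truncated subtraction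
  from the block sizes. Counted from 0, the Julia block occupies rows and columns \<open>r\<close>
  and \<open>Suc r\<close>.\<close>

lemma julia_factor_eq_four_block:
  "julia_factor \<gamma> k (k + (Suc r + a)) (Suc r) =
    four_block_mat (1\<^sub>m r) (0\<^sub>m r (2 + a)) (0\<^sub>m (2 + a) r)
      (four_block_mat (julia (\<gamma> k (k + Suc r))) (0\<^sub>m 2 a) (0\<^sub>m a 2) (1\<^sub>m a))"
  unfolding julia_factor_def diag_block_mat.simps(2)[of "1\<^sub>m (Suc r - 1)"]
    diag_block_mat.simps(2)[of "julia (\<gamma> k (k + Suc r))"] diag_block_mat_singleton Let_def
  by simp

lemma julia_factor_carrier:
  assumes "r < n"
  shows "julia_factor \<gamma> k (k + n) (Suc r) \<in> carrier_mat (Suc n) (Suc n)"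
proof -
  obtain a where n: "n = Suc r + a"
    using assms less_imp_Suc_add by auto
  show ?thesis
    unfolding n julia_factor_eq_four_block by (intro carrier_matI) simp_all
qed

lemma julia_factor_index:
  assumes "r < n" "p \<le> n" "q \<le> n"
  shows "julia_factor \<gamma> k (k + n) (Suc r) $$ (p, q) =
    (if p \<in> {r, Suc r} \<and> q \<in> {r, Suc r} then julia (\<gamma> k (k + Suc r)) $$ (p - r, q - r)
     else if p = q then 1 else 0)"
proof -
  obtain a where n: "n = Suc r + a"
    using assms less_imp_Suc_add by auto
  \<comment> \<open>Each index lies before the Julia block, on one of its two lines, or after
    it.\<close>
  have "x < r \<or> x = r \<or> x = Suc r \<or> (\<exists>y. x = Suc (Suc (r + y)))" for x
    using less_imp_Suc_add[of "Suc r" x] by (cases "Suc r < x") auto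
  note this[of p] this[of q]
  then show ?thesis
    using assms(2,3) unfolding n julia_factor_eq_four_block by (elim disjE exE) simp_all
qed

lemma julia_factor_mult_index:
  assumes A: "A \<in> carrier_mat (Suc n) N" and r: "r < n" and c: "c < N"
  shows "p \<le> n \<Longrightarrow> p \<notin> {r, Suc r} \<Longrightarrow>
      (julia_factor \<gamma> k (k + n) (Suc r) * A) $$ (p, c) = A $$ (p, c)"
    and "(julia_factor \<gamma> k (k + n) (Suc r) * A) $$ (r, c) =
      \<gamma> k (k + Suc r) * A $$ (r, c) + complex_of_real (defect (\<gamma> k (k + Suc r))) * A $$ (Suc r, c)"
    and "(julia_factor \<gamma> k (k + n) (Suc r) * A) $$ (Suc r, c) =
      complex_of_real (defect (\<gamma> k (k + Suc r))) * A $$ (r, c) - cnj (\<gamma> k (k + Suc r)) * A $$ (Suc r, c)"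
proof -
  let ?J = "julia_factor \<gamma> k (k + n) (Suc r)"
  have J: "?J \<in> carrier_mat (Suc n) (Suc n)"
    using r by (rule julia_factor_carrier)
  have mult: "(?J * A) $$ (p, c) = (\<Sum>q<Suc n. ?J $$ (p, q) * A $$ (q, c))" if "p \<le> n" for p
    using J A c that by (auto simp: scalar_prod_def lessThan_atLeast0 intro!: sum.cong)
  show "(?J * A) $$ (p, c) = A $$ (p, c)" if "p \<le> n" "p \<notin> {r, Suc r}"
  proof -
    have "(?J * A) $$ (p, c) = (\<Sum>q<Suc n. if p = q then A $$ (q, c) else 0)"
      unfolding mult[OF that(1)] using that r
      by (intro sum.cong) (auto simp: julia_factor_index)
    then show ?thesis using that by simp
  qed
  have two: "(?J * A) $$ (p, c) =
      ?J $$ (p, r) * A $$ (r, c) + ?J $$ (p, Suc r) * A $$ (Suc r, c)" if "p \<in> {r, Suc r}" for p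
  proof -
    have "(?J * A) $$ (p, c) = (\<Sum>q\<in>{r, Suc r}. ?J $$ (p, q) * A $$ (q, c))"
    proof (subst mult)
      show "p \<le> n" using that r by auto
      show "(\<Sum>q<Suc n. ?J $$ (p, q) * A $$ (q, c)) = (\<Sum>q\<in>{r, Suc r}. ?J $$ (p, q) * A $$ (q, c))"
        using that r by (intro sum.mono_neutral_right) (auto simp: julia_factor_index)
    qed
    then show ?thesis by simp
  qed
  show "(?J * A) $$ (r, c) =
      \<gamma> k (k + Suc r) * A $$ (r, c) + complex_of_real (defect (\<gamma> k (k + Suc r))) * A $$ (Suc r, c)"
    using r by (simp add: two julia_factor_index julia_index)
  show "(?J * A) $$ (Suc r, c) =
      complex_of_real (defect (\<gamma> k (k + Suc r))) * A $$ (r, c) - cnj (\<gamma> k (k + Suc r)) * A $$ (Suc r, c)"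
    using r by (simp add: two julia_factor_index julia_index)
qed

text \<open>Induction with \<open>k\<close> arbitrary, since the recursion raises the left index and
  keeps the right index \<open>k + n\<close>. The dimensions are carried along because the entry
  formulas for products need them.\<close>

lemma param_U_index:
  "param_U \<gamma> k (k + n) \<in> carrier_mat (Suc n) (Suc n) \<and>
   (\<forall>p\<le>n. param_U \<gamma> k (k + n) $$ (p, 0) = path_sum \<gamma> (k + n) k (k + p) Fall)"
proof (induction n arbitrary: k)
  case 0
  show ?case by (simp add: param_U.simps[of \<gamma> k k] path_sum_end)
next
  case (Suc n)
  define m where "m = k + Suc n"
  define B where "B = diag_block_mat [param_U \<gamma> (Suc k) m, 1\<^sub>m 1]"
  \<comment> \<open>\<open>M s\<close> is the product from factor \<open>s\<close> onwards; its rows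
    are followed as \<open>s\<close> decreases from \<open>Suc (Suc n)\<close> to 1.\<close>
  define M where "M s = foldr (\<lambda>r A. julia_factor \<gamma> k (k + Suc n) r * A) [s..<Suc (Suc n)] B" for s
  have m: "Suc k + n = m" by (simp add: m_def)
  have IH: "param_U \<gamma> (Suc k) m \<in> carrier_mat (Suc n) (Suc n)"
    "param_U \<gamma> (Suc k) m $$ (p, 0) = path_sum \<gamma> m (Suc k) (Suc k + p) Fall" if "p \<le> n" for p
    using Suc.IH[of "Suc k"] that unfolding m by auto
  have dims: "dim_row (param_U \<gamma> (Suc k) m) = Suc n" "dim_col (param_U \<gamma> (Suc k) m) = Suc n"
    using IH(1)[of 0] by simp_all
  have B_eq: "B = four_block_mat (param_U \<gamma> (Suc k) m) (0\<^sub>m (Suc n) 1) (0\<^sub>m 1 (Suc n)) (1\<^sub>m 1)"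
    unfolding B_def diag_block_mat.simps(2)[of "param_U \<gamma> (Suc k) m"] diag_block_mat_singleton Let_def
    by (simp add: dims)
  have B: "B \<in> carrier_mat (Suc (Suc n)) (Suc (Suc n))"
    unfolding B_eq by (intro carrier_matI) (simp_all add: dims)
  have B_index: "B $$ (p, 0) = path_sum \<gamma> m (Suc k) (Suc k + p) Fall" if "p \<le> n" for p
    using that IH(2)[OF that] by (simp add: B_eq dims)
  have B_last: "B $$ (Suc n, 0) = 0"
    by (simp add: B_eq dims)
  have U: "param_U \<gamma> k m = M 1"
    unfolding param_U.simps[of \<gamma> k m] M_def B_def by (simp add: m_def del: upt_Suc)
  have M_rec: "M r = julia_factor \<gamma> k (k + Suc n) r * M (Suc r)" if "r \<le> Suc n" for r
    using that by (simp add: M_def upt_conv_Cons del: upt_Suc)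
  have M_end: "M (Suc (Suc n)) = B"
    by (simp add: M_def)
  have M: "M r \<in> carrier_mat (Suc (Suc n)) (Suc (Suc n))" if "r \<le> Suc (Suc n)" "1 \<le> r" for r
    using that
  proof (induction r rule: inc_induct)
    case (step r)
    then have "julia_factor \<gamma> k (k + Suc n) r \<in> carrier_mat (Suc (Suc n)) (Suc (Suc n))"
      using julia_factor_carrier[of "r - 1" "Suc n" \<gamma> k] by auto
    then show ?case
      using step by (simp add: M_rec mult_carrier_mat[of _ "Suc (Suc n)" "Suc (Suc n)"])
  qed (simp add: M_end B)
  have M_skip: "M (Suc r) $$ (p, 0) = M (Suc (Suc r)) $$ (p, 0)"
    if "r \<le> n" "p \<le> Suc n" "p \<notin> {r, Suc r}" for r p
    using that julia_factor_mult_index(1)[OF M[of "Suc (Suc r)"], of r 0 p] M_rec[of "Suc r"] by simp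
  have M_upper: "M (Suc r) $$ (r, 0) = \<gamma> k (k + Suc r) * M (Suc (Suc r)) $$ (r, 0)
      + complex_of_real (defect (\<gamma> k (k + Suc r))) * M (Suc (Suc r)) $$ (Suc r, 0)" if "r \<le> n" for r
    using that julia_factor_mult_index(2)[OF M[of "Suc (Suc r)"], of r 0] M_rec[of "Suc r"] by simp
  have M_lower: "M (Suc r) $$ (Suc r, 0) =
      complex_of_real (defect (\<gamma> k (k + Suc r))) * M (Suc (Suc r)) $$ (r, 0)
      - cnj (\<gamma> k (k + Suc r)) * M (Suc (Suc r)) $$ (Suc r, 0)" if "r \<le> n" for r
    using that julia_factor_mult_index(3)[OF M[of "Suc (Suc r)"], of r 0] M_rec[of "Suc r"] by simp
  \<comment> \<open>Factors \<open>Suc r\<close> and later touch only rows from \<open>r\<close> on,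
    so these rows are still those of \<open>B\<close>.\<close>
  have below: "M (Suc r) $$ (p, 0) = path_sum \<gamma> m (Suc k) (Suc k + p) Fall"
    if "r \<le> Suc n" "p < r" for r p
    using that
  proof (induction r rule: inc_induct)
    case base
    then show ?case by (simp add: M_end B_index)
  next
    case (step r)
    then show ?case by (simp add: M_skip)
  qed
  \<comment> \<open>The upper row of factor \<open>Suc r\<close>: a fall leads into an untouched row
    of \<open>B\<close>, a rise into the upper row of the next factor.\<close>
  have rising: "M (Suc r) $$ (r, 0) = path_sum \<gamma> m k (k + Suc r) Rise" if "r \<le> Suc n" for r
    using that
  proof (induction r rule: inc_induct)
    case base
    \<comment> \<open>The zero below the block of \<open>U\<close> in \<open>B\<close> matches the
      absence of paths from \<open>(k, m + 1)\<close>, which is too high to come down in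
      time.\<close>
    then show ?case by (simp add: M_end B_last path_sum_high m_def)
  next
    case (step r)
    have "M (Suc r) $$ (r, 0) = \<gamma> k (k + Suc r) * path_sum \<gamma> m (Suc k) (Suc k + r) Fall +
        complex_of_real (defect (\<gamma> k (k + Suc r))) * path_sum \<gamma> m k (k + Suc (Suc r)) Rise"
      using step below[of "Suc r" r] by (simp add: M_upper)
    also have "\<dots> = path_sum \<gamma> m k (k + Suc r) Rise"
      using step by (subst path_sum_rec[of k "k + Suc r"]) (auto simp: node_weight_def m_def)
    finally show ?case .
  qed
  \<comment> \<open>Rows beyond \<open>r\<close> are final, since factors 1 to \<open>r\<close>
    touch only rows 0 to \<open>r\<close>.\<close>
  have above: "M (Suc r) $$ (p, 0) = M 1 $$ (p, 0)" if "r < p" "p \<le> Suc n" for r p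
    using that
  proof (induction r)
    case (Suc r)
    then show ?case using M_skip[of r p] by simp
  qed simp
  have "param_U \<gamma> k m $$ (p, 0) = path_sum \<gamma> m k (k + p) Fall" if "p \<le> Suc n" for p
  proof (cases p)
    case 0
    have "param_U \<gamma> k m $$ (p, 0) = path_sum \<gamma> m k (Suc k) Rise"
      using rising[of 0] by (simp add: U 0)
    \<comment> \<open>On the axis only a rise is possible and the weight is 1, so the preceding step
      does not matter.\<close>
    also have "\<dots> = path_sum \<gamma> m k k Fall"
      by (subst (2) path_sum_rec) (auto simp: path_sum_neg node_weight_def m_def)
    finally show ?thesis by (simp add: 0)
  next
    case (Suc r)
    \<comment> \<open>Row \<open>Suc r\<close> receives its final value as the lower row of factor
      \<open>Suc r\<close>, which belongs to entering by a fall.\<close>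
    have "param_U \<gamma> k m $$ (p, 0) = M (Suc r) $$ (Suc r, 0)"
      using above[of r p] that by (simp add: U Suc)
    also have "\<dots> = complex_of_real (defect (\<gamma> k (k + Suc r))) * path_sum \<gamma> m (Suc k) (Suc k + r) Fall
        - cnj (\<gamma> k (k + Suc r)) * path_sum \<gamma> m k (k + Suc (Suc r)) Rise"
      using that Suc below[of "Suc r" r] rising[of "Suc r"] by (simp add: M_lower)
    also have "\<dots> = path_sum \<gamma> m k (k + p) Fall"
      using that Suc by (subst path_sum_rec[of k "k + p"]) (auto simp: node_weight_def m_def)
    finally show ?thesis .
  qed
  then show ?case
    using M[of 1] unfolding U[symmetric] m_def[symmetric] by simp
qed

section \<open>The weight of a Dyck path\<close>

text \<open>The two counts recover the indices: after \<open>t\<close> steps from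
  \<open>(i, j)\<close> a path is at \<open>(i + falls q t, j + rises q t)\<close>.\<close>

abbreviation rises :: "step list \<Rightarrow> nat \<Rightarrow> nat" where
  "rises q t \<equiv> count_list (take t q) Rise"

abbreviation falls :: "step list \<Rightarrow> nat \<Rightarrow> nat" where
  "falls q t \<equiv> count_list (take t q) Fall"

lemma path_height_rises_falls: "path_height q t = int (rises q t) - int (falls q t)"
proof (induction q arbitrary: t)
  case (Cons s q)
  show ?case
  proof (cases t)
    case (Suc t')
    then show ?thesis using Cons.IH[of t'] by (cases s) auto
  qed simp
qed (simp add: path_height_def)

lemma rises_plus_falls: "t \<le> length q \<Longrightarrow> rises q t + falls q t = t"
proof (induction q arbitrary: t)
  case (Cons s q)
  show ?case
  proof (cases t)
    case (Suc t')
    then show ?thesis using Cons.IH[of t'] Cons.prems by (cases s) auto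
  qed simp
qed simp

lemma count_list_take_le: "count_list (take t q) x \<le> count_list q x"
  by (metis append_take_drop_id count_list_append le_add1)

text \<open>Prepending \<open>s\<close> makes \<open>(s # q) ! t\<close> the step before time
  \<open>t\<close>, also for \<open>t = 0\<close>.\<close>

lemma path_weight_eq_prod:
  "path_weight \<gamma> i j s q =
     (\<Prod>t<length q. node_weight \<gamma> (i + falls q t) (j + rises q t) ((s # q) ! t) (q ! t))"
proof (induction q arbitrary: i j s)
  case (Cons u q)
  show ?case
    by (cases u) (simp_all add: Cons.IH prod.lessThan_Suc_shift del: prod.lessThan_Suc)
qed simp

text \<open>Times of positive height correspond injectively to visited pairs \<open>i < j\<close>;
  unvisited pairs and times on the axis both contribute 1.\<close>

lemma prod_dyck_weight:
  assumes q: "q \<in> dyck_paths l m"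
  shows "(\<Prod>(i, j)\<in>{(i, j). l \<le> i \<and> i < j \<and> j \<le> m}. dyck_weight \<gamma> l q i j) =
    path_weight \<gamma> l l Fall q"
proof -
  let ?P = "{(i, j). l \<le> i \<and> i < j \<and> j \<le> m}"
  define N where "N = length q"
  define f where "f t = (l + falls q t, l + rises q t)" for t
  define T where "T = {t. t < N \<and> 0 < path_height q t}"
  have N: "N = 2 * (m - l)" and h: "\<And>t. t \<le> N \<Longrightarrow> 0 \<le> path_height q t" "path_height q N = 0"
    using q by (auto simp: dyck_paths_def N_def)
  have sum_t: "rises q t + falls q t = t" if "t \<le> N" for t
    using rises_plus_falls that by (simp add: N_def)
  \<comment> \<open>The path ends at height 0, so half of its steps are rises; this bounds the
    second index by \<open>m\<close>.\<close>
  have total: "count_list q Rise = m - l"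
    using h(2) sum_t[of N] unfolding path_height_rises_falls by (simp add: N_def N[unfolded N_def])
  have bound: "rises q t \<le> m - l" for t
    using count_list_take_le[of t q Rise] total by simp
  have inj: "inj_on f T"
  proof (rule inj_onI)
    fix t u assume "t \<in> T" "u \<in> T" "f t = f u"
    then have "rises q t = rises q u" "falls q t = falls q u" "t \<le> N" "u \<le> N"
      by (auto simp: f_def T_def)
    then show "t = u" using sum_t[of t] sum_t[of u] by linarith
  qed
  have sub: "f ` T \<subseteq> ?P"
  proof
    fix x assume "x \<in> f ` T"
    then obtain t where t: "x = f t" "t < N" "0 < path_height q t" by (auto simp: T_def)
    then have "l < m" using N by auto
    then show "x \<in> ?P"
      using t bound[of t] unfolding path_height_rises_falls f_def by auto
  qed
  have fin: "finite ?P"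
    by (rule finite_subset[of _ "{..m} \<times> {..m}"]) auto
  \<comment> \<open>A weight other than 1 forces the path through the point of \<open>(i, j)\<close>
    at time \<open>j + i - 2 * l\<close>, which makes the pair a value of \<open>f\<close>.\<close>
  have off_path: "dyck_weight \<gamma> l q i j = 1" if ij: "(i, j) \<in> ?P - f ` T" for i j
  proof (rule ccontr)
    define t where "t = j + i - 2 * l"
    assume "dyck_weight \<gamma> l q i j \<noteq> 1"
    then have ht: "path_height q t = int j - int i"
      by (auto simp: dyck_weight_def t_def Let_def split: if_splits)
    have t: "t < N" "0 < path_height q t"
      using ij unfolding ht by (auto simp: t_def N)
    have "f t = (i, j)"
      using ht sum_t[of t] t ij unfolding path_height_rises_falls f_def by (auto simp: t_def)
    then show False
      using t ij by (force simp: T_def)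
  qed
  have on_path: "(case f t of (i, j) \<Rightarrow> dyck_weight \<gamma> l q i j) =
      node_weight \<gamma> (l + falls q t) (l + rises q t) ((Fall # q) ! t) (q ! t)" if "t \<in> T" for t
  proof -
    have t: "t < N" "falls q t < rises q t"
      using that by (auto simp: T_def path_height_rises_falls)
    \<comment> \<open>Hence \<open>(Fall # q) ! t\<close> is \<open>q ! (t - 1)\<close>, and the
      fictitious initial fall is never read.\<close>
    have "t \<noteq> 0" using t by (cases t) auto
    have "(l + rises q t) + (l + falls q t) - 2 * l = t"
      using sum_t[of t] t by simp
    then show ?thesis
      using t \<open>t \<noteq> 0\<close> unfolding f_def prod.case dyck_weight_def Let_def
      by (simp add: node_weight_def path_height_rises_falls nth_Cons')
  qed
  have on_axis: "node_weight \<gamma> (l + falls q t) (l + rises q t) ((Fall # q) ! t) (q ! t) = 1"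
    if "t \<in> {..<N} - T" for t
    using that h(1)[of t] by (auto simp: T_def path_height_rises_falls node_weight_def)
  have "(\<Prod>(i, j)\<in>?P. dyck_weight \<gamma> l q i j) = (\<Prod>(i, j)\<in>f ` T. dyck_weight \<gamma> l q i j)"
    using fin sub off_path by (intro prod.mono_neutral_right) auto
  also have "\<dots> = (\<Prod>t\<in>T. node_weight \<gamma> (l + falls q t) (l + rises q t) ((Fall # q) ! t) (q ! t))"
    using on_path by (simp add: prod.reindex[OF inj])
  also have "\<dots> = (\<Prod>t<N. node_weight \<gamma> (l + falls q t) (l + rises q t) ((Fall # q) ! t) (q ! t))"
    using on_axis by (intro prod.mono_neutral_left) (auto simp: T_def)
  finally show ?thesis
    by (simp add: path_weight_eq_prod N_def)
qed

theorem theorem2p2: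
  fixes K \<gamma> :: "nat \<Rightarrow> nat \<Rightarrow> complex"
  assumes "pos_def_kernel K"
    and "\<forall>l. K l l = 1"
    and "associated_parameters K \<gamma>"
  shows "\<forall>l m. l < m \<longrightarrow>
    K l m = (\<Sum>q\<in>dyck_paths l m. \<Prod>(i, j)\<in>{(i, j). l \<le> i \<and> i < j \<and> j \<le> m}. dyck_weight \<gamma> l q i j)"
proof (intro allI impI)
  fix l m :: nat
  assume "l < m"
  have "K l m = param_U \<gamma> l m $$ (0, 0)"
    using assms(3) \<open>l < m\<close> by (simp add: associated_parameters_def)
  also have "\<dots> = path_sum \<gamma> m l l Fall"
    using param_U_index[of \<gamma> l "m - l"] \<open>l < m\<close> by simp
  also have "\<dots> = (\<Sum>q\<in>dyck_paths l m. path_weight \<gamma> l l Fall q)"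
    by (simp add: path_sum_def dyck_paths_eq_paths_from diff_mult_distrib2 flip: mult_2)
  also have "\<dots> = (\<Sum>q\<in>dyck_paths l m.
      \<Prod>(i, j)\<in>{(i, j). l \<le> i \<and> i < j \<and> j \<le> m}. dyck_weight \<gamma> l q i j)"
    by (intro sum.cong refl prod_dyck_weight[symmetric])
  finally show "K l m = (\<Sum>q\<in>dyck_paths l m.
      \<Prod>(i, j)\<in>{(i, j). l \<le> i \<and> i < j \<and> j \<le> m}. dyck_weight \<gamma> l q i j)" .
qed

end
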